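(* Let $T$ be a $\{1,3\}$-tree with $n$ nodes of degree $3$, so that $T$ has $2n+1$ edges and $\mathcal{P}_T\subset\mathbb{R}^E\cong\mathbb{R}^{2n+1}$, and let $H$ be a collection of pairwise vertex-disjoint leaf-paths in $T$. Define $h_H:\mathbb{R}^E\to\mathbb{R}^E$ by $h_H(w)_e=\frac12-w_e$ if $e\in E(H)$ and $h_H(w)_e=w_e$ otherwise. Then $h_H$ is an isometry of $\mathcal{P}_T$ to itself (i.e. $h_H$ is an isometry with $h_H(\mathcal{P}_T)=\mathcal{P}_T$).
   Context: A $\{1,3\}$-tree is a finite tree all of whose nodes have degree $1$ (leaves) or $3$ (internal nodes); $E$ is its edge set. A leaf-edge is an edge incident with a leaf; a leaf-path is a path in $T$ whose two extreme edges are leaf-edges (a single edge joining two leaves is a leaf-path). $\mathcal{P}_T\subset\mathbb{R}^E$ is the set of $w$ such that for every internal node $v$ with incident edges $a,b,c$: $w_a\le w_b+w_c$, $w_b\le w_a+w_c$, $w_c\le w_a+w_b$, $w_a+w_b+w_c\le1$; and if $T$ is a single edge $e$, $\mathcal{P}_T=\{w:0\le w_e\le\frac12\}$. *)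

theory Defs
  imports "HOL-Analysis.Analysis"
begin

text \<open>
  A finite simple graph is given by its node set \<open>V\<close> and a map \<open>ends\<close> sending each edge to its
  two-element set of end nodes.  The edge set is the whole finite type \<open>'e\<close>, so that the
  Euclidean space of edge weights is \<open>real ^ 'e\<close>.
\<close>

definition simple_graph :: "'v set \<Rightarrow> ('e::finite \<Rightarrow> 'v set) \<Rightarrow> bool" where
  "simple_graph V ends \<longleftrightarrow>
     finite V \<and> inj ends \<and> (\<forall>e. ends e \<subseteq> V \<and> card (ends e) = 2)"

definition incident_edges :: "('e::finite \<Rightarrow> 'v set) \<Rightarrow> 'v \<Rightarrow> 'e set" where
  "incident_edges ends v = {e. v \<in> ends e}"

definition degree :: "('e::finite \<Rightarrow> 'v set) \<Rightarrow> 'v \<Rightarrow> nat" where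
  "degree ends v = card (incident_edges ends v)"

text \<open>Walks, paths and cycles are represented by their sequences of nodes.\<close>

definition is_walk :: "'v set \<Rightarrow> ('e::finite \<Rightarrow> 'v set) \<Rightarrow> 'v list \<Rightarrow> bool" where
  "is_walk V ends p \<longleftrightarrow>
     p \<noteq> [] \<and> set p \<subseteq> V \<and> successively (\<lambda>u v. {u, v} \<in> range ends) p"

definition is_path :: "'v set \<Rightarrow> ('e::finite \<Rightarrow> 'v set) \<Rightarrow> 'v list \<Rightarrow> bool" where
  "is_path V ends p \<longleftrightarrow> is_walk V ends p \<and> distinct p"

definition is_cycle :: "'v set \<Rightarrow> ('e::finite \<Rightarrow> 'v set) \<Rightarrow> 'v list \<Rightarrow> bool" where
  "is_cycle V ends p \<longleftrightarrow>
     is_path V ends p \<and> length p \<ge> 3 \<and> {last p, hd p} \<in> range ends"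

definition is_tree :: "'v set \<Rightarrow> ('e::finite \<Rightarrow> 'v set) \<Rightarrow> bool" where
  "is_tree V ends \<longleftrightarrow>
     simple_graph V ends \<and> V \<noteq> {} \<and>
     (\<forall>u\<in>V. \<forall>v\<in>V. \<exists>p. is_walk V ends p \<and> hd p = u \<and> last p = v) \<and>
     (\<nexists>p. is_cycle V ends p)"

definition one_three_tree :: "'v set \<Rightarrow> ('e::finite \<Rightarrow> 'v set) \<Rightarrow> bool" where
  "one_three_tree V ends \<longleftrightarrow>
     is_tree V ends \<and> (\<forall>v\<in>V. degree ends v = 1 \<or> degree ends v = 3)"

definition leaves :: "'v set \<Rightarrow> ('e::finite \<Rightarrow> 'v set) \<Rightarrow> 'v set" where
  "leaves V ends = {v \<in> V. degree ends v = 1}"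

definition internal_nodes :: "'v set \<Rightarrow> ('e::finite \<Rightarrow> 'v set) \<Rightarrow> 'v set" where
  "internal_nodes V ends = {v \<in> V. degree ends v = 3}"

definition leaf_edge :: "'v set \<Rightarrow> ('e::finite \<Rightarrow> 'v set) \<Rightarrow> 'e \<Rightarrow> bool" where
  "leaf_edge V ends e \<longleftrightarrow> ends e \<inter> leaves V ends \<noteq> {}"

definition path_edge :: "('e::finite \<Rightarrow> 'v set) \<Rightarrow> 'v list \<Rightarrow> nat \<Rightarrow> 'e" where
  "path_edge ends p i = (THE e. ends e = {p ! i, p ! Suc i})"

definition path_edges :: "('e::finite \<Rightarrow> 'v set) \<Rightarrow> 'v list \<Rightarrow> 'e set" where
  "path_edges ends p = path_edge ends p ` {i. Suc i < length p}"

text \<open>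
  A path consisting of a single edge is a leaf-path only if both its end nodes are leaves: the two
  extreme edges of a one-edge path coincide, and one leaf does not count for both of them.
\<close>

definition leaf_path :: "'v set \<Rightarrow> ('e::finite \<Rightarrow> 'v set) \<Rightarrow> 'v list \<Rightarrow> bool" where
  "leaf_path V ends p \<longleftrightarrow>
     is_path V ends p \<and> length p \<ge> 2 \<and>
     (if length p = 2 then hd p \<in> leaves V ends \<and> last p \<in> leaves V ends
      else leaf_edge V ends (path_edge ends p 0) \<and>
           leaf_edge V ends (path_edge ends p (length p - 2)))"

definition tree_polytope :: "'v set \<Rightarrow> ('e::finite \<Rightarrow> 'v set) \<Rightarrow> (real ^ 'e) set" where
  "tree_polytope V ends =
     (if CARD('e) = 1 then {w. \<forall>e. 0 \<le> w $ e \<and> w $ e \<le> 1/2}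
      else {w. \<forall>v \<in> internal_nodes V ends. \<forall>a b c.
              distinct [a, b, c] \<and> incident_edges ends v = {a, b, c} \<longrightarrow>
                w $ a \<le> w $ b + w $ c \<and> w $ b \<le> w $ a + w $ c \<and>
                w $ c \<le> w $ a + w $ b \<and> w $ a + w $ b + w $ c \<le> 1})"

definition edge_flip :: "('e::finite \<Rightarrow> 'v set) \<Rightarrow> 'v list set \<Rightarrow> real ^ 'e \<Rightarrow> real ^ 'e" where
  "edge_flip ends H w =
     (\<chi> e. if e \<in> (\<Union>p\<in>H. path_edges ends p) then 1/2 - w $ e else w $ e)"

definition isometry :: "('a::metric_space \<Rightarrow> 'b::metric_space) \<Rightarrow> bool" where
  "isometry f \<longleftrightarrow> bij f \<and> (\<forall>x y. dist (f x) (f y) = dist x y)"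

end

theory Submission
  imports Defs
begin

text \<open>
  The end nodes of a leaf-path are leaves, so a leaf-path meets an internal node \<open>v\<close> in no edge or in
  exactly two; as the paths of \<open>H\<close> are disjoint, \<open>E(H)\<close> contains no or exactly two of the
  three edges at \<open>v\<close>.  Substituting \<open>1/2 - w\<close> for two of the three weights at \<open>v\<close> permutes the four
  inequalities at \<open>v\<close>, so the involution \<open>h\<^sub>H\<close> maps the polytope into, hence onto, itself.

  The number of edges comes from \<open>|V| = |E| + 1\<close> and the handshake lemma.
\<close>

section \<open>Counting the edges of a tree\<close>

text \<open>
  The first node of a longest path has at most one neighbour, since any other one would either extend
  the path or close a cycle; removing that node is the induction step.
\<close>

lemma acyclic_card_edges_less:
  fixes V :: "'v set" and E :: "'v set set"
  assumes "finite V" "V \<noteq> {}" "\<forall>e\<in>E. e \<subseteq> V \<and> card e = 2"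
    and "\<forall>p. set p \<subseteq> V \<and> distinct p \<and> successively (\<lambda>u v. {u, v} \<in> E) p \<and> length p \<ge> 3
           \<longrightarrow> {last p, hd p} \<notin> E"
  shows "card E < card V"
  using assms
proof (induction "card V" arbitrary: V E rule: less_induct)
  case less
  note finV = less.prems(1) and ne = less.prems(2) and E = less.prems(3) and acyc = less.prems(4)
  have finE: "finite E"
    using E finV by (meson finite_Pow_iff finite_subset Pow_iff subsetI)
  \<comment> \<open>Distinct nodes of \<open>V\<close> bound the length by \<open>card V\<close>, so
    \<open>P\<close> has a longest element; its first node \<open>v\<close> is the one to be
    deleted.\<close>
  define P where
    "P = {p. set p \<subseteq> V \<and> distinct p \<and> p \<noteq> [] \<and> successively (\<lambda>u v. {u, v} \<in> E) p}"
  obtain x where x: "x \<in> V" using ne by auto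
  have "[x] \<in> P" using x by (simp add: P_def)
  moreover have "length p < Suc (card V)" if "p \<in> P" for p
    using that finV by (auto simp: P_def distinct_card[symmetric] less_Suc_eq_le intro!: card_mono)
  ultimately obtain p where p: "p \<in> P" and longest: "\<And>q. q \<in> P \<Longrightarrow> length q \<le> length p"
    using ex_has_greatest_nat[of "\<lambda>p. p \<in> P" "[x]" length "Suc (card V)"] by (meson less_imp_le_nat)
  then obtain v ps where vps: "p = v # ps" by (cases p) (auto simp: P_def)
  have vV: "v \<in> V" using p vps by (simp add: P_def)
  have nbr: "ps \<noteq> [] \<and> u = hd ps" if u: "{u, v} \<in> E" for u
  proof -
    have "u \<noteq> v" "u \<in> V" using E u by fastforce+
    have "u \<in> set ps"
    proof (rule ccontr)
      assume "u \<notin> set ps"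
      then have "u # p \<in> P" using p vps u \<open>u \<noteq> v\<close> \<open>u \<in> V\<close> by (simp add: P_def)
      from longest[OF this] show False by simp
    qed
    then obtain xs ys where ps: "ps = xs @ u # ys" by (meson split_list)
    have "xs = []"
    proof (rule ccontr)
      assume "xs \<noteq> []"
      \<comment> \<open>The edge \<open>{u, v}\<close> closes this initial segment of
        \<open>p\<close> to a cycle; a nonempty \<open>xs\<close> makes it at least three nodes
        long.\<close>
      let ?c = "v # xs @ [u]"
      have "p = ?c @ ys" using vps ps by simp
      moreover from this have "successively (\<lambda>u v. {u, v} \<in> E) ?c"
        using p unfolding P_def by (simp only: successively_append_iff mem_Collect_eq)
      ultimately have "set ?c \<subseteq> V \<and> distinct ?c \<and> successively (\<lambda>u v. {u, v} \<in> E) ?c \<and> length ?c \<ge> 3"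
        using p \<open>xs \<noteq> []\<close> by (cases xs) (auto simp: P_def)
      then have "{last ?c, hd ?c} \<notin> E" using acyc by blast
      then show False using u by simp
    qed
    then show ?thesis using ps by simp
  qed
  define D where "D = {e \<in> E. v \<in> e}"
  have "D \<subseteq> {{hd ps, v}}"
  proof
    fix e assume e: "e \<in> D"
    then have "card e = 2" "v \<in> e" using E by (auto simp: D_def)
    then obtain u where "e = {u, v}" by (auto simp: card_2_iff)
    then show "e \<in> {{hd ps, v}}" using nbr e by (auto simp: D_def)
  qed
  then have cD: "card D \<le> 1" by (metis card.empty card_mono finite.emptyI finite_insert card_insert_if
        empty_iff One_nat_def)
  have "card E = card (E - D) + card D"
    using finE by (metis (no_types, lifting) D_def card_Diff_subset card_mono finite_subset
        le_add_diff_inverse2 mem_Collect_eq subsetI)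
  \<comment> \<open>The induction hypothesis needs a nonempty node set, so the one-node graph is
    treated apart.\<close>
  moreover have "card (E - D) + card D < card V"
  proof (cases "V = {v}")
    case True
    have "E = {}"
    proof (rule ccontr)
      assume "E \<noteq> {}"
      then obtain e where "e \<subseteq> {v}" "card e = 2" using E True by auto
      then show False using card_mono[of "{v}" e] by simp
    qed
    then show ?thesis using True by (simp add: D_def)
  next
    case False
    have lt: "card (V - {v}) < card V" using vV finV by (meson card_Diff1_less)
    have "card (E - D) < card (V - {v})"
    proof (rule less.hyps[OF lt])
      show "finite (V - {v})" "V - {v} \<noteq> {}" using finV False vV by auto
      show "\<forall>e\<in>E - D. e \<subseteq> V - {v} \<and> card e = 2" using E by (auto simp: D_def)
      show "\<forall>p. set p \<subseteq> V - {v} \<and> distinct p \<and> successively (\<lambda>u v. {u, v} \<in> E - D) p \<and>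
          length p \<ge> 3 \<longrightarrow> {last p, hd p} \<notin> E - D"
      proof (intro allI impI)
        fix p assume p: "set p \<subseteq> V - {v} \<and> distinct p \<and>
          successively (\<lambda>u v. {u, v} \<in> E - D) p \<and> length p \<ge> 3"
        then have "successively (\<lambda>u v. {u, v} \<in> E) p"
          by (blast intro: successively_mono)
        then have "{last p, hd p} \<notin> E" using acyc p by blast
        then show "{last p, hd p} \<notin> E - D" by blast
      qed
    qed
    then show ?thesis using cD lt by linarith
  qed
  ultimately show ?case by simp
qed

text \<open>Some step of the sequence must cross from \<open>S\<close> to its complement. Recording
  \<open>y \<in> set p\<close> ensures later that the new node lies in \<open>V\<close>.\<close>

lemma successively_leaves_set:
  assumes "successively R p" "p \<noteq> []" "hd p \<in> S" "last p \<notin> S"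
  shows "\<exists>x y. x \<in> S \<and> y \<notin> S \<and> R x y \<and> y \<in> set p"
  using assms
proof (induction p)
  case (Cons x p)
  then show ?case by (cases p) (auto split: if_splits)
qed simp

text \<open>
  A largest node set \<open>S\<close> spanning at least \<open>|S| - 1\<close> edges is all of \<open>V\<close>: otherwise connectivity
  provides an edge leaving \<open>S\<close>, whose other end node could be added.
\<close>

lemma connected_card_nodes_le:
  fixes V :: "'v set" and E :: "'v set set"
  assumes finV: "finite V" and finE: "finite E" and r: "r \<in> V"
    and conn: "\<forall>v\<in>V. \<exists>p. p \<noteq> [] \<and> set p \<subseteq> V \<and> successively (\<lambda>u v. {u, v} \<in> E) p \<and>
      hd p = r \<and> last p = v"
  shows "card V \<le> card E + 1"
proof -
  \<comment> \<open>The summand 1 lets \<open>{r}\<close> satisfy \<open>Q\<close> without any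
    edge.\<close>
  define Q where "Q S \<longleftrightarrow> r \<in> S \<and> S \<subseteq> V \<and> card S \<le> card {e \<in> E. e \<subseteq> S} + 1" for S
  have "Q {r}" using r by (simp add: Q_def)
  moreover have "card S < Suc (card V)" if "Q S" for S
    using that finV by (simp add: Q_def less_Suc_eq_le card_mono)
  ultimately obtain S where S: "Q S" and max: "\<And>S'. Q S' \<Longrightarrow> card S' \<le> card S"
    using ex_has_greatest_nat[of Q "{r}" card "Suc (card V)"] by (meson less_imp_le_nat)
  have finS: "finite S" using S finV by (auto simp: Q_def intro: finite_subset)
  have "S = V"
  proof (rule ccontr)
    assume "S \<noteq> V"
    then obtain v where v: "v \<in> V" "v \<notin> S" using S by (auto simp: Q_def)
    then obtain p where p: "p \<noteq> []" "set p \<subseteq> V" "successively (\<lambda>u v. {u, v} \<in> E) p"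
      "hd p = r" "last p = v" using conn by blast
    then obtain x y where xy: "x \<in> S" "y \<notin> S" "{x, y} \<in> E" "y \<in> V"
      using successively_leaves_set[OF p(3,1), of S] S v by (auto simp: Q_def)
    \<comment> \<open>Since \<open>{x, y}\<close> is not inside \<open>S\<close>, adding
      \<open>y\<close> gains at least one edge for one node, which preserves
      \<open>Q\<close>.\<close>
    have "insert {x, y} {e \<in> E. e \<subseteq> S} \<subseteq> {e \<in> E. e \<subseteq> insert y S}" using xy by auto
    then have "card (insert {x, y} {e \<in> E. e \<subseteq> S}) \<le> card {e \<in> E. e \<subseteq> insert y S}"
      using finE by (intro card_mono) auto
    moreover have "card (insert {x, y} {e \<in> E. e \<subseteq> S}) = Suc (card {e \<in> E. e \<subseteq> S})"
      using finE xy by (subst card_insert_disjoint) auto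
    ultimately have "Q (insert y S)" using S xy finS by (simp add: Q_def)
    from max[OF this] show False using xy finS by simp
  qed
  then have "card V \<le> card {e \<in> E. e \<subseteq> V} + 1" using S by (simp add: Q_def)
  also have "\<dots> \<le> card E + 1" using finE by (simp add: card_mono)
  finally show ?thesis .
qed

text \<open>Acyclicity and connectivity give the two bounds; injectivity of \<open>ends\<close>
  turns the count of \<open>range ends\<close> into one of the edge type.\<close>

lemma tree_card_nodes:
  fixes ends :: "'e::finite \<Rightarrow> 'v set"
  assumes "is_tree V ends"
  shows "card V = CARD('e) + 1"
proof -
  have sg: "finite V" "inj ends" "\<forall>e. ends e \<subseteq> V \<and> card (ends e) = 2" and "V \<noteq> {}"
    using assms by (auto simp: is_tree_def simple_graph_def)
  then obtain r where r: "r \<in> V" by auto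
  have cE: "card (range ends) = CARD('e)" using sg by (simp add: card_image)
  have "card (range ends) < card V"
    using assms sg \<open>V \<noteq> {}\<close>
    by (intro acyclic_card_edges_less) (auto simp: is_tree_def is_cycle_def is_path_def is_walk_def)
  moreover have "card V \<le> card (range ends) + 1"
    using assms r sg by (intro connected_card_nodes_le[of _ _ r]) (auto simp: is_tree_def is_walk_def)
  ultimately show ?thesis using cE by simp
qed

lemma handshake:
  fixes ends :: "'e::finite \<Rightarrow> 'v set"
  assumes "simple_graph V ends"
  shows "(\<Sum>v\<in>V. degree ends v) = 2 * CARD('e)"
proof -
  have sg: "finite V" "\<And>e. ends e \<subseteq> V" "\<And>e. card (ends e) = 2"
    using assms by (auto simp: simple_graph_def)
  then have "{v \<in> V. v \<in> ends e} = ends e" for e by blast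
  then have "(\<Sum>v\<in>V. card {e \<in> UNIV. v \<in> ends e}) = 2 * CARD('e)"
    using sg by (intro sum_multicount) auto
  then show ?thesis by (simp add: degree_def incident_edges_def)
qed

text \<open>With L leaves, I internal nodes and E edges, L + 3I = 2E and L + I = E + 1; subtracting
  eliminates L.\<close>

lemma one_three_tree_card_edges:
  fixes ends :: "'e::finite \<Rightarrow> 'v set"
  assumes "one_three_tree V ends"
  shows "CARD('e) = 2 * card (internal_nodes V ends) + 1"
proof -
  let ?L = "leaves V ends" and ?I = "internal_nodes V ends"
  have sg: "simple_graph V ends" and tree: "is_tree V ends"
    using assms by (auto simp: one_three_tree_def is_tree_def)
  then have "finite V" by (simp add: simple_graph_def)
  have V: "V = ?L \<union> ?I" and disj: "?L \<inter> ?I = {}" and fin: "finite ?L" "finite ?I"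
    using assms \<open>finite V\<close> by (auto simp: one_three_tree_def leaves_def internal_nodes_def)
  have "2 * CARD('e) = (\<Sum>v\<in>?L. degree ends v) + (\<Sum>v\<in>?I. degree ends v)"
    using handshake[OF sg] sum.union_disjoint[OF fin disj, of "degree ends"] V by simp
  also have "\<dots> = card ?L + 3 * card ?I"
    by (simp add: leaves_def internal_nodes_def)
  finally have "2 * CARD('e) = card ?L + 3 * card ?I" .
  moreover have "card ?L + card ?I = CARD('e) + 1"
    using tree_card_nodes[OF tree] card_Un_disjoint[OF fin disj] V by simp
  ultimately show ?thesis by linarith
qed

section \<open>Leaf-paths at an internal node\<close>

text \<open>Justifies the definite description in \<open>path_edge\<close>: the walk supplies an
  edge, and injectivity of \<open>ends\<close> makes it unique.\<close>

lemma ends_path_edge: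
  assumes "simple_graph V ends" "is_path V ends p" "Suc i < length p"
  shows "ends (path_edge ends p i) = {p ! i, p ! Suc i}"
proof -
  have "{p ! i, p ! Suc i} \<in> range ends"
    using assms successively_nth[of "\<lambda>u v. {u, v} \<in> range ends" p i]
    by (simp add: is_path_def is_walk_def)
  then obtain e where e: "ends e = {p ! i, p ! Suc i}" by (metis imageE)
  have "inj ends" using assms by (simp add: simple_graph_def)
  then have "path_edge ends p i = e"
    using e unfolding path_edge_def by (metis (mono_tags, lifting) injD the_equality)
  then show ?thesis using e by simp
qed

lemma card_path_edges_at_interior_node:
  fixes ends :: "'e::finite \<Rightarrow> 'v set"
  assumes sg: "simple_graph V ends" and p: "is_path V ends p" and i: "Suc (Suc i) < length p"
  shows "card (path_edges ends p \<inter> incident_edges ends (p ! Suc i)) = 2"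
proof -
  note ends = ends_path_edge[OF sg p]
  have dist: "distinct p" using p by (simp add: is_path_def)
  have "path_edges ends p \<inter> incident_edges ends (p ! Suc i)
      = path_edge ends p ` {j. Suc j < length p \<and> p ! Suc i \<in> ends (path_edge ends p j)}"
    by (auto simp: path_edges_def incident_edges_def)
  \<comment> \<open>As the nodes are distinct, edge \<open>j\<close> meets node \<open>Suc i\<close>
    only if \<open>j\<close> or \<open>Suc j\<close> equals \<open>Suc i\<close>.\<close>
  also have "{j. Suc j < length p \<and> p ! Suc i \<in> ends (path_edge ends p j)} = {i, Suc i}"
    using dist i by (auto simp: ends nth_eq_iff_index_eq)
  finally have eq: "path_edges ends p \<inter> incident_edges ends (p ! Suc i)
      = {path_edge ends p i, path_edge ends p (Suc i)}" by simp
  have "p ! i \<noteq> p ! Suc i" "p ! i \<noteq> p ! Suc (Suc i)"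
    using dist i by (auto simp: nth_eq_iff_index_eq)
  then have "ends (path_edge ends p i) \<noteq> ends (path_edge ends p (Suc i))"
    using i by (auto simp: ends)
  then show ?thesis unfolding eq by (metis card_2_iff)
qed

lemma interior_node_not_leaf:
  fixes ends :: "'e::finite \<Rightarrow> 'v set"
  assumes "simple_graph V ends" "is_path V ends p" "Suc (Suc i) < length p"
  shows "p ! Suc i \<notin> leaves V ends"
proof -
  have "2 \<le> degree ends (p ! Suc i)"
    unfolding degree_def card_path_edges_at_interior_node[OF assms, symmetric]
    by (intro card_mono) auto
  then show ?thesis by (simp add: leaves_def)
qed

text \<open>An extreme edge of a longer path has a leaf among its ends, and its inner end has degree
  at least 2, so the leaf is the outer end. For two nodes the definition of \<open>leaf_path\<close>
  asks for both leaves directly.\<close>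

lemma leaf_path_ends_leaves:
  fixes ends :: "'e::finite \<Rightarrow> 'v set"
  assumes sg: "simple_graph V ends" and lp: "leaf_path V ends p"
  shows "p ! 0 \<in> leaves V ends" "p ! (length p - 1) \<in> leaves V ends"
proof -
  have p: "is_path V ends p" and len: "length p \<ge> 2" using lp by (auto simp: leaf_path_def)
  have "p ! 0 \<in> leaves V ends \<and> p ! (length p - 1) \<in> leaves V ends"
  proof (cases "length p = 2")
    case True
    then have "p \<noteq> []" by auto
    then show ?thesis using lp True by (simp add: leaf_path_def hd_conv_nth last_conv_nth)
  next
    case False
    \<comment> \<open>The last edge has index \<open>Suc k\<close> and its inner end is
      \<open>p ! Suc k\<close>; for \<open>k = 0\<close> both extreme edges share the same inner
      node.\<close>
    then obtain k where k: "length p = Suc (Suc (Suc k))"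
      using len by (metis One_nat_def Suc_1 Suc_le_D le_antisym not_less_eq_eq)
    have "leaf_edge V ends (path_edge ends p 0)" "leaf_edge V ends (path_edge ends p (Suc k))"
      using lp False k by (auto simp: leaf_path_def)
    then show ?thesis
      using interior_node_not_leaf[OF sg p, of 0] interior_node_not_leaf[OF sg p, of k] k
      by (auto simp: leaf_edge_def ends_path_edge[OF sg p])
  qed
  then show "p ! 0 \<in> leaves V ends" "p ! (length p - 1) \<in> leaves V ends" by auto
qed

lemma card_leaf_path_edges_at_internal_node:
  fixes ends :: "'e::finite \<Rightarrow> 'v set"
  assumes sg: "simple_graph V ends" and lp: "leaf_path V ends p"
    and v: "v \<in> internal_nodes V ends" "v \<in> set p"
  shows "card (path_edges ends p \<inter> incident_edges ends v) = 2"
proof -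
  obtain j where j: "j < length p" "v = p ! j" using v by (auto simp: in_set_conv_nth)
  have "v \<notin> leaves V ends" using v by (simp add: internal_nodes_def leaves_def)
  then have "j \<noteq> 0" "j \<noteq> length p - 1"
    using leaf_path_ends_leaves[OF sg lp] unfolding j(2) by metis+
  then obtain i where "j = Suc i" "Suc (Suc i) < length p" using j by (cases j) auto
  then show ?thesis
    using card_path_edges_at_interior_node[OF sg] lp j by (simp add: leaf_path_def)
qed

text \<open>A path with an edge at \<open>v\<close> passes through \<open>v\<close>, and by
  disjointness at most one path of \<open>H\<close> does so.\<close>

lemma disjoint_leaf_paths_edges_at_internal_node:
  fixes ends :: "'e::finite \<Rightarrow> 'v set"
  assumes sg: "simple_graph V ends" and lps: "\<forall>p\<in>H. leaf_path V ends p"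
    and disj: "pairwise (\<lambda>p q. disjnt (set p) (set q)) H"
    and v: "v \<in> internal_nodes V ends"
  shows "card ((\<Union>p\<in>H. path_edges ends p) \<inter> incident_edges ends v) \<in> {0, 2}"
proof -
  have on_path: "v \<in> set p" if e: "p \<in> H" "e \<in> path_edges ends p" "e \<in> incident_edges ends v" for p e
  proof -
    obtain i where "Suc i < length p" "e = path_edge ends p i"
      using e by (auto simp: path_edges_def)
    then show ?thesis
      using e lps ends_path_edge[OF sg, of p i] by (auto simp: leaf_path_def incident_edges_def)
  qed
  show ?thesis
  proof (cases "\<exists>p\<in>H. v \<in> set p")
    case True
    then obtain p where p: "p \<in> H" "v \<in> set p" by blast
    have "q = p" if "q \<in> H" "v \<in> set q" for q
      using disj p that by (auto simp: pairwise_def disjnt_def)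
    then have "(\<Union>p\<in>H. path_edges ends p) \<inter> incident_edges ends v
        = path_edges ends p \<inter> incident_edges ends v"
      using on_path p by blast
    then show ?thesis using card_leaf_path_edges_at_internal_node[OF sg _ v] lps p by simp
  next
    case False
    then have "(\<Union>p\<in>H. path_edges ends p) \<inter> incident_edges ends v = {}" using on_path by blast
    then show ?thesis by simp
  qed
qed

section \<open>The flip map\<close>

lemma edge_flip_involution: "edge_flip ends H (edge_flip ends H w) = w"
  by (simp add: edge_flip_def vec_eq_iff)

text \<open>Each coordinate undergoes the identity or the reflection of t to 1/2 - t, both
  distance-preserving; being an involution gives bijectivity.\<close>

lemma isometry_edge_flip: "isometry (edge_flip ends H)"
proof -
  have "bij (edge_flip ends H)"
    by (rule o_bij[of "edge_flip ends H"]) (auto simp: edge_flip_involution)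
  moreover have "dist (edge_flip ends H x) (edge_flip ends H y) = dist x y" for x y
    unfolding dist_vec_def by (rule L2_set_cong) (auto simp: edge_flip_def dist_real_def)
  ultimately show ?thesis by (simp add: isometry_def)
qed

lemma edge_flip_in_tree_polytope:
  fixes ends :: "'e::finite \<Rightarrow> 'v set"
  assumes sg: "simple_graph V ends" and lps: "\<forall>p\<in>H. leaf_path V ends p"
    and disj: "pairwise (\<lambda>p q. disjnt (set p) (set q)) H"
    and w: "w \<in> tree_polytope V ends"
  shows "edge_flip ends H w \<in> tree_polytope V ends"
proof (cases "CARD('e) = 1")
  case True
  then show ?thesis using w by (auto simp: tree_polytope_def edge_flip_def)
next
  case False
  let ?F = "\<Union>p\<in>H. path_edges ends p" and ?w = "edge_flip ends H w"
  have "?w $ a \<le> ?w $ b + ?w $ c \<and> ?w $ b \<le> ?w $ a + ?w $ c \<and>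
        ?w $ c \<le> ?w $ a + ?w $ b \<and> ?w $ a + ?w $ b + ?w $ c \<le> 1"
    if v: "v \<in> internal_nodes V ends" and abc: "distinct [a, b, c]" "incident_edges ends v = {a, b, c}"
    for v a b c
  proof -
    have ineq: "w $ a \<le> w $ b + w $ c \<and> w $ b \<le> w $ a + w $ c \<and>
        w $ c \<le> w $ a + w $ b \<and> w $ a + w $ b + w $ c \<le> 1"
      using w v abc False by (simp add: tree_polytope_def)
    have flip: "?w $ e = (if e \<in> ?F then 1/2 - w $ e else w $ e)" for e
      by (simp add: edge_flip_def)
    \<comment> \<open>Excluding \<open>UN_iff\<close> keeps membership in \<open>?F\<close> atomic
      for the case split below.\<close>
    have "card (?F \<inter> {a, b, c}) = of_bool (a \<in> ?F) + of_bool (b \<in> ?F) + of_bool (c \<in> ?F)"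
      using abc(1) by (simp add: Int_insert_right del: UN_iff)
    then have "of_bool (a \<in> ?F) + of_bool (b \<in> ?F) + of_bool (c \<in> ?F) \<in> {0, 2::nat}"
      using disjoint_leaf_paths_edges_at_internal_node[OF sg lps disj v] abc(2) by simp
    \<comment> \<open>One or three flips contradict the count. If exactly \<open>a\<close> and
      \<open>b\<close> are flipped, the inequalities bounding \<open>a\<close> and \<open>b\<close>
      are exchanged, as are the one bounding \<open>c\<close> and the one bounding the sum by
      1.\<close>
    then show ?thesis
      using ineq unfolding flip
      by (cases "a \<in> ?F"; cases "b \<in> ?F"; cases "c \<in> ?F") (simp_all del: UN_iff)
  qed
  then show ?thesis using False by (simp add: tree_polytope_def)
qed

theorem theorem6:
  fixes V :: "'v set" and ends :: "'e::finite \<Rightarrow> 'v set" and H :: "'v list set" and n :: nat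
  assumes "one_three_tree V ends"
    and "card (internal_nodes V ends) = n"
    and "\<forall>p\<in>H. leaf_path V ends p"
    and "pairwise (\<lambda>p q. disjnt (set p) (set q)) H"
  shows "CARD('e) = 2 * n + 1 \<and>
         isometry (edge_flip ends H) \<and>
         edge_flip ends H ` tree_polytope V ends = tree_polytope V ends"
proof (intro conjI)
  show "CARD('e) = 2 * n + 1" using one_three_tree_card_edges[OF assms(1)] assms(2) by simp
  show "isometry (edge_flip ends H)" by (rule isometry_edge_flip)
  have "simple_graph V ends" using assms(1) by (simp add: one_three_tree_def is_tree_def)
  note into = edge_flip_in_tree_polytope[OF this assms(3,4)]
  show "edge_flip ends H ` tree_polytope V ends = tree_polytope V ends"
  proof (intro subset_antisym image_subsetI subsetI)
    show "edge_flip ends H w \<in> tree_polytope V ends" if "w \<in> tree_polytope V ends" for w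
      using that by (rule into)
    \<comment> \<open>The preimage of \<open>w\<close> is its own flip.\<close>
    show "w \<in> edge_flip ends H ` tree_polytope V ends" if "w \<in> tree_polytope V ends" for w
      using into[OF that] by (rule rev_image_eqI) (simp add: edge_flip_involution)
  qed
qed

end
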